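(* Let $\mathcal{L}$ be a linear order on $[p]$ and let $\rho:[p]\to\mathbb{N}$ be a map such that $\overline{\rho}^{\mathcal{L}}(i)\ge 1$ for all $i\in[p]$. Then $\mathrm{red}(\mathcal{L},\rho)=\mathrm{des}(\mathcal{L},\rho)$ if and only if for all $i\prec\!\cdot\, j$ in $\mathcal{L}$ with $i<j$ we have $\overline{\rho}^{\mathcal{L}}(i)=\overline{\rho}^{\mathcal{L}}(j)$. Moreover, when this is the case, $\mathfrak{F}_{(\mathcal{L},\rho)}=\mathfrak{F}_{\mathrm{red}(\mathcal{L},\rho)}$. Conversely, for any weak composition $a$, there exist a linear order $\mathcal{L}$ (on some $[p]$) and a map $\rho:[p]\to\mathbb{N}$ such that $\mathfrak{F}_{(\mathcal{L},\rho)}=\mathfrak{F}_a$.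
   Context: A poset $\mathcal{P}$ on $[p]=\{1,\dots,p\}$ ($p\ge 0$) is a partial order $\prec$ on $[p]$; $i\prec\!\cdot\, j$ means $j$ covers $i$; $<$ is the natural order on integers. $\mathbb{N}=\{1,2,3,\dots\}$. Given $\rho:[p]\to\mathbb{Z}$, a $(\mathcal{P},\rho)$-partition is a function $f:[p]\to\mathbb{N}$ such that (1) if $i\prec j$ then $f(i)\le f(j)$; (2) if $i\prec j$ and $i>j$ then $f(i)<f(j)$; (3) $f(i)\le\rho(i)$ for all $i$. Let $\mathscr{A}_\rho(\mathcal{P})$ be the set of these and $\mathfrak{F}_{(\mathcal{P},\rho)}=\sum_{f\in\mathscr{A}_\rho(\mathcal{P})}x_{f(1)}\cdots x_{f(p)}$. For $i\preceq j$ in $\mathcal{P}$ let $\delta(i,j)$ be the maximum, over all chains $i=i_0\prec i_1\prec\cdots\prec i_k=j$ in $\mathcal{P}$, of the number of indices $t\in\{1,\dots,k\}$ with $i_{t-1}>i_t$. Define $\overline{\rho}^{\mathcal{P}}(i)=\min\{\rho(x)-\delta(i,x)\mid i\preceq x\}$. For a linear order $\mathcal{L}$ on $[p]$ and $\rho$ with $\overline{\rho}^{\mathcal{L}}\ge1$ everywhere, define two weak compositions. (1) $\mathrm{red}(\mathcal{L},\rho)$: in the Hasse diagram of $\mathcal{L}$ remove every edge $i\prec\!\cdot\, j$ with $i>j$; let $C_1,\dots,C_r$ be the resulting chains in ascending order of $\mathcal{L}$, and let $c_s=\overline{\rho}^{\mathcal{L}}(\min_{\mathcal{L}}C_s)$;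 the $c_s$-th part of $\mathrm{red}(\mathcal{L},\rho)$ is $|C_s|$ for $s=1,\dots,r$ and all other parts are $0$. (2) $\mathrm{des}(\mathcal{L},\rho)$: remove every edge $i\prec\!\cdot\, j$ with $\overline{\rho}^{\mathcal{L}}(i)<\overline{\rho}^{\mathcal{L}}(j)$; let $C'_1,\dots,C'_\ell$ be the resulting chains in ascending order, and $c'_s=\overline{\rho}^{\mathcal{L}}(\min_{\mathcal{L}}C'_s)$; the $c'_s$-th part of $\mathrm{des}(\mathcal{L},\rho)$ is $|C'_s|$ and all other parts are $0$. A weak composition is a finite sequence of nonnegative integers (considered up to trailing zeros); a strong composition is a finite sequence of positive integers. $\mathrm{flat}(a)$ is obtained from $a$ by removing zeros. A strong composition $\beta$ refines $\alpha$ if they have the same total sum and every partial sum $\alpha_1+\cdots+\alpha_j$ equals some partial sum of $\beta$. $b\trianglerighteq a$ means $b_1+\cdots+b_k\ge a_1+\cdots+a_k$ for all $k$. For a weak composition $a$ of length $n$, the slide polynomial is $\mathfrak{F}_a=\sum_b x_1^{b_1}\cdots x_n^{b_n}$, the sum over weak compositions $b$ of length $n$ with $b\trianglerighteq a$ and $\mathrm{flat}(b)$ refining $\mathrm{flat}(a)$. (Appending trailing zeros to $a$ does not change $\mathfrak{F}_a$.) *)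

theory Defs
  imports "HOL-Library.Poly_Mapping" "HOL-Library.FuncSet" "HOL-Library.More_List"
begin

text \<open>
  A poset on \<open>[p]\<close> is a relation \<open>P\<close> with \<open>partial_order_on {1..p} P\<close>, where
  \<open>(i, j) \<in> P\<close> means \<open>i \<preceq> j\<close>; the order \<open><\<close> on \<open>nat\<close> is the natural order of the labels.
  Maps \<open>\<rho>\<close> on \<open>[p]\<close> are total functions whose values outside \<open>{1..p}\<close> are irrelevant.
\<close>

definition strictly_below :: "nat rel \<Rightarrow> nat \<Rightarrow> nat \<Rightarrow> bool" where
  "strictly_below P i j \<longleftrightarrow> (i, j) \<in> P \<and> i \<noteq> j"

definition covered_by :: "nat rel \<Rightarrow> nat \<Rightarrow> nat \<Rightarrow> bool" where
  "covered_by P i j \<longleftrightarrow>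
     strictly_below P i j \<and> \<not> (\<exists>k. strictly_below P i k \<and> strictly_below P k j)"


subsection \<open>Generating polynomials of bounded partitions\<close>

text \<open>
  Polynomials over the integers in the variables \<open>x\<^sub>1, x\<^sub>2, \<dots>\<close>: a finitely supported map from
  exponent vectors to coefficients, with the convolution product of \<open>poly_mapping\<close>.
\<close>

type_synonym polynomial = "(nat \<Rightarrow>\<^sub>0 nat) \<Rightarrow>\<^sub>0 int"

definition Var :: "nat \<Rightarrow> polynomial" where
  "Var i = Poly_Mapping.single (Poly_Mapping.single i 1) 1"

definition bounded_partitions :: "nat \<Rightarrow> nat rel \<Rightarrow> (nat \<Rightarrow> int) \<Rightarrow> (nat \<Rightarrow> nat) set" where
  "bounded_partitions p P \<rho> =
     {f \<in> {1..p} \<rightarrow>\<^sub>E {1..}.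
        (\<forall>i j. strictly_below P i j \<longrightarrow> f i \<le> f j) \<and>
        (\<forall>i j. strictly_below P i j \<and> i > j \<longrightarrow> f i < f j) \<and>
        (\<forall>i\<in>{1..p}. int (f i) \<le> \<rho> i)}"

definition partition_poly :: "nat \<Rightarrow> nat rel \<Rightarrow> (nat \<Rightarrow> int) \<Rightarrow> polynomial" where
  "partition_poly p P \<rho> = (\<Sum>f\<in>bounded_partitions p P \<rho>. \<Prod>i\<in>{1..p}. Var (f i))"


subsection \<open>The tightened bound\<close>

definition chains_between :: "nat rel \<Rightarrow> nat \<Rightarrow> nat \<Rightarrow> nat list set" where
  "chains_between P i j =
     {xs. xs \<noteq> [] \<and> hd xs = i \<and> last xs = j \<and> successively (strictly_below P) xs}"

definition descent_count :: "nat list \<Rightarrow> nat" where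
  "descent_count xs = card {t. Suc t < length xs \<and> xs ! t > xs ! Suc t}"

definition delta :: "nat rel \<Rightarrow> nat \<Rightarrow> nat \<Rightarrow> nat" where
  "delta P i j = Max (descent_count ` chains_between P i j)"

definition rho_bar :: "nat rel \<Rightarrow> (nat \<Rightarrow> int) \<Rightarrow> nat \<Rightarrow> int" where
  "rho_bar P \<rho> i = Min {\<rho> x - int (delta P i x) |x. (i, x) \<in> P}"


subsection \<open>Weak compositions\<close>

text \<open>
  A weak composition of length \<open>n\<close> is a list of \<open>n\<close> natural numbers; its \<open>c\<close>-th part
  (counted from 1) is the list entry with index \<open>c - 1\<close>.
\<close>

definition same_weak_comp :: "nat list \<Rightarrow> nat list \<Rightarrow> bool" where
  "same_weak_comp a b \<longleftrightarrow> strip_while (\<lambda>x. x = 0) a = strip_while (\<lambda>x. x = 0) b"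

definition flat :: "nat list \<Rightarrow> nat list" where
  "flat a = filter (\<lambda>x. x \<noteq> 0) a"

definition comp_refines :: "nat list \<Rightarrow> nat list \<Rightarrow> bool" where
  "comp_refines \<beta> \<alpha> \<longleftrightarrow>
     sum_list \<beta> = sum_list \<alpha> \<and>
     (\<forall>j\<le>length \<alpha>. \<exists>k\<le>length \<beta>. sum_list (take j \<alpha>) = sum_list (take k \<beta>))"

definition dominates :: "nat list \<Rightarrow> nat list \<Rightarrow> bool" where
  "dominates b a \<longleftrightarrow> (\<forall>k. sum_list (take k b) \<ge> sum_list (take k a))"

definition slide_poly :: "nat list \<Rightarrow> polynomial" where
  "slide_poly a =
     (\<Sum>b \<in> {b. length b = length a \<and> dominates b a \<and> comp_refines (flat b) (flat a)}.
        \<Prod>i<length a. Var (Suc i) ^ (b ! i))"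


subsection \<open>The two weak compositions of a bounded linear order\<close>

text \<open>
  The chains left over after deleting edges from a Hasse diagram on \<open>{1..p}\<close> are the connected
  components of the graph formed by the surviving edges \<open>E\<close>.
\<close>

definition components :: "nat \<Rightarrow> nat rel \<Rightarrow> nat set set" where
  "components p E = {1..p} // ((E \<union> E\<inverse>)\<^sup>*)"

definition red_chains :: "nat \<Rightarrow> nat rel \<Rightarrow> nat set set" where
  "red_chains p L = components p {(i, j). covered_by L i j \<and> \<not> i > j}"

definition des_chains :: "nat \<Rightarrow> nat rel \<Rightarrow> (nat \<Rightarrow> int) \<Rightarrow> nat set set" where
  "des_chains p L \<rho> =
     components p {(i, j). covered_by L i j \<and> \<not> rho_bar L \<rho> i < rho_bar L \<rho> j}"

definition min_of :: "nat rel \<Rightarrow> nat set \<Rightarrow> nat" where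
  "min_of L C = (THE m. m \<in> C \<and> (\<forall>x\<in>C. (m, x) \<in> L))"

definition chain_pos :: "nat rel \<Rightarrow> (nat \<Rightarrow> int) \<Rightarrow> nat set \<Rightarrow> nat" where
  "chain_pos L \<rho> C = nat (rho_bar L \<rho> (min_of L C))"

text \<open>
  The weak composition with part \<open>card C\<close> in position \<open>chain_pos L \<rho> C\<close> for every chain \<open>C\<close> and
  zeros elsewhere. For a linear order, \<open>rho_bar\<close> is weakly increasing along the order and strictly
  increasing across every deleted edge, in \<open>red\<close> as well as in \<open>des\<close>. So distinct chains have
  distinct positions, and the sum has at most one term.
\<close>

definition chains_to_comp :: "nat rel \<Rightarrow> (nat \<Rightarrow> int) \<Rightarrow> nat set set \<Rightarrow> nat list" where
  "chains_to_comp L \<rho> \<C> =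
     map (\<lambda>c. \<Sum>C\<in>{C \<in> \<C>. chain_pos L \<rho> C = c}. card C)
       [1..<Suc (Max (insert 0 (chain_pos L \<rho> ` \<C>)))]"

definition red :: "nat \<Rightarrow> nat rel \<Rightarrow> (nat \<Rightarrow> int) \<Rightarrow> nat list" where
  "red p L \<rho> = chains_to_comp L \<rho> (red_chains p L)"

definition des :: "nat \<Rightarrow> nat rel \<Rightarrow> (nat \<Rightarrow> int) \<Rightarrow> nat list" where
  "des p L \<rho> = chains_to_comp L \<rho> (des_chains p L \<rho>)"

end

theory Submission
  imports Defs
begin

text \<open>
  List the elements of the linear order as \<open>w\<^sub>1 \<prec> \<dots> \<prec> w\<^sub>p\<close> and write \<open>R\<close> for the tightened bound
  \<open>rho_bar\<close>. Two properties of \<open>R\<close> carry everything. First, \<open>R i + [i > j] \<le> R j\<close> whenever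
  \<open>i \<prec> j\<close>, because a chain from \<open>j\<close> upwards can be prolonged by \<open>i\<close> (\<open>rho_bar_step\<close>). Second,
  every bounded partition already satisfies \<open>f \<le> R\<close>, because \<open>f\<close> increases by at least one at
  each descent of a chain (\<open>bounded_partition_le_rho_bar\<close>); so \<open>\<rho>\<close> may be replaced by \<open>R\<close>.

  Along the order \<open>R\<close> is weakly increasing, so the chains of \<open>des\<close> are the level sets of \<open>R\<close> and
  its \<open>c\<close>-th part counts the \<open>i\<close> with \<open>R i = c\<close> (\<open>nth_default_des\<close>). If every ascending cover
  preserves \<open>R\<close>, then \<open>red\<close> and \<open>des\<close> delete the same edges. Conversely, suppose that \<open>i\<close> is
  covered by \<open>j\<close>, \<open>i < j\<close> and \<open>R i < R j\<close>. Then part \<open>R j\<close> of \<open>des\<close> is positive. A positive part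
  \<open>R j\<close> of \<open>red\<close> needs a chain whose least element \<open>m\<close> has \<open>R m = R j\<close>; it cannot lie below \<open>j\<close>,
  where \<open>R\<close> is smaller, nor be \<open>j\<close>, whose chain contains \<open>i\<close>, nor lie above \<open>j\<close>, since the
  descent into \<open>m\<close> would force \<open>R j < R m\<close> (\<open>ascent_of_same_weak_comp\<close>).

  For the generating functions, send a map \<open>f\<close> that is weakly increasing along the order to the
  sequence \<open>b\<close> of its level sizes. This is a bijection onto weak compositions of \<open>p\<close>, the inverse
  being the quantile function of the partial sums of \<open>b\<close>, and it matches monomials. With \<open>a\<close> the
  level sizes of \<open>R\<close>, domination of \<open>a\<close> by \<open>b\<close> means \<open>f \<le> R\<close>, and \<open>flat b\<close> refines \<open>flat a\<close> iff
  \<open>f\<close> strictly increases wherever \<open>R\<close> does. Hence \<open>slide_poly a\<close> is the sum over these maps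
  (\<open>slide_poly_level_counts\<close>). When every ascending cover preserves \<open>R\<close>, the covers across which
  \<open>R\<close> increases are exactly the descents, so these maps are exactly the bounded partitions
  (\<open>bounded_partitions_eq_staircase_maps\<close>).

  Every slide polynomial arises in the same way: for a given \<open>a\<close>, take as bound the weakly
  decreasing sequence with level sizes \<open>a\<close> and order the labels by bound, ties by label.
\<close>

section \<open>Partial sums, level sets and quantiles\<close>

definition level_counts :: "nat \<Rightarrow> nat \<Rightarrow> (nat \<Rightarrow> nat) \<Rightarrow> nat list" where
  "level_counts p n f = map (\<lambda>c. card {i \<in> {1..p}. f i = Suc c}) [0..<n]"

lemma length_level_counts [simp]: "length (level_counts p n f) = n"
  by (simp add: level_counts_def)

lemma nth_level_counts:
  "c < n \<Longrightarrow> level_counts p n f ! c = card {i \<in> {1..p}. f i = Suc c}"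
  by (simp add: level_counts_def)

lemma funcset_interval_bounds:
  fixes f :: "nat \<Rightarrow> nat"
  assumes "f \<in> A \<rightarrow> {1..n}" "i \<in> A"
  shows "1 \<le> f i" "f i \<le> n"
  using funcset_mem[OF assms] by simp_all

lemma level_counts_cong:
  assumes "\<And>i. i \<in> {1..p} \<Longrightarrow> f i = g i"
  shows "level_counts p n f = level_counts p n g"
proof -
  have "{i \<in> {1..p}. f i = Suc c} = {i \<in> {1..p}. g i = Suc c}" for c
    using assms by auto
  then show ?thesis
    by (simp add: level_counts_def)
qed

lemma sum_list_take_mono:
  fixes b :: "nat list"
  assumes "c \<le> d"
  shows "sum_list (take c b) \<le> sum_list (take d b)"
proof -
  have "take d b = take c b @ take (d - c) (drop c b)"
    using assms by (metis le_add_diff_inverse take_add)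
  then show ?thesis
    by simp
qed

lemma sum_list_take_level_counts:
  assumes "f \<in> {1..p} \<rightarrow> {1..n}"
  shows "sum_list (take c (level_counts p n f)) = card {i \<in> {1..p}. f i \<le> c}"
proof -
  have below: "sum_list (take c (level_counts p n f)) = card {i \<in> {1..p}. f i \<le> c}"
    if "c \<le> n" for c
    using that
  proof (induction c)
    case 0
    have "{i \<in> {1..p}. f i \<le> 0} = {}"
      using funcset_interval_bounds(1)[OF assms] by fastforce
    then show ?case
      by simp
  next
    case (Suc c)
    have "{i \<in> {1..p}. f i \<le> Suc c} = {i \<in> {1..p}. f i \<le> c} \<union> {i \<in> {1..p}. f i = Suc c}"
      by auto
    then have "card {i \<in> {1..p}. f i \<le> Suc c}
        = card {i \<in> {1..p}. f i \<le> c} + card {i \<in> {1..p}. f i = Suc c}"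
      by (simp only:) (rule card_Un_disjoint, auto)
    with Suc show ?case
      by (simp add: take_Suc_conv_app_nth nth_level_counts)
  qed
  show ?thesis
  proof (cases "c \<le> n")
    case False
    then have "{i \<in> {1..p}. f i \<le> c} = {i \<in> {1..p}. f i \<le> n}"
      using funcset_interval_bounds(2)[OF assms] by fastforce
    with below[of n] False show ?thesis
      by simp
  qed (rule below)
qed

lemma sum_list_level_counts:
  assumes "f \<in> {1..p} \<rightarrow> {1..n}"
  shows "sum_list (level_counts p n f) = p"
proof -
  have "{i \<in> {1..p}. f i \<le> n} = {1..p}"
    using funcset_interval_bounds(2)[OF assms] by blast
  with sum_list_take_level_counts[OF assms, of n] show ?thesis
    by simp
qed

text \<open>
  For a weak composition \<open>b\<close>, this is the block in which the \<open>k\<close>-th unit falls: the value at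
  \<open>k\<close> of the weakly increasing sequence that takes each value \<open>c\<close> as often as the \<open>c\<close>-th part says.
\<close>

definition quantile :: "nat list \<Rightarrow> nat \<Rightarrow> nat" where
  "quantile b k = (LEAST c. k \<le> sum_list (take c b))"

text \<open>
  The quantile function and the partial sums are adjoint; all other facts about quantiles come
  from this equivalence.
\<close>

lemma quantile_le_iff:
  assumes "k \<le> sum_list b"
  shows "quantile b k \<le> c \<longleftrightarrow> k \<le> sum_list (take c b)"
proof
  have "k \<le> sum_list (take (length b) b)"
    using assms by simp
  then have "k \<le> sum_list (take (quantile b k) b)"
    unfolding quantile_def by (rule LeastI)
  also assume "quantile b k \<le> c"
  then have "sum_list (take (quantile b k) b) \<le> sum_list (take c b)"
    by (rule sum_list_take_mono)
  finally show "k \<le> sum_list (take c b)" .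
next
  assume "k \<le> sum_list (take c b)"
  then show "quantile b k \<le> c"
    unfolding quantile_def by (rule Least_le)
qed

lemma quantile_in_range:
  assumes "k \<in> {1..sum_list b}"
  shows "quantile b k \<in> {1..length b}"
  using quantile_le_iff[of k b 0] quantile_le_iff[of k b "length b"] assms by auto

lemma quantile_mono:
  assumes "k \<le> l" "l \<le> sum_list b"
  shows "quantile b k \<le> quantile b l"
  using quantile_le_iff[of k b "quantile b l"] quantile_le_iff[of l b "quantile b l"] assms
  by simp

text \<open>
  Reading the quantile function through any bijection \<open>\<sigma>\<close> recovers \<open>b\<close>. The bijection is the rank
  function of a linear order when maps are rebuilt from weak compositions, and the reversal of
  \<open>[p]\<close> when a decreasing bound is needed.
\<close>

lemma level_counts_quantile:
  assumes \<sigma>: "bij_betw \<sigma> {1..p} {1..p}" and p: "p = sum_list b"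
  shows "level_counts p (length b) (\<lambda>i. quantile b (\<sigma> i)) = b"
proof (rule nth_equalityI)
  fix c assume "c < length (level_counts p (length b) (\<lambda>i. quantile b (\<sigma> i)))"
  then have c: "c < length b"
    by simp
  have le: "quantile b k \<le> d \<longleftrightarrow> k \<le> sum_list (take d b)" if "k \<in> {1..p}" for k d
    using quantile_le_iff that p by simp
  have "\<sigma> ` {i \<in> {1..p}. quantile b (\<sigma> i) = Suc c} = {k \<in> {1..p}. quantile b k = Suc c}"
  proof
    show "{k \<in> {1..p}. quantile b k = Suc c} \<subseteq> \<sigma> ` {i \<in> {1..p}. quantile b (\<sigma> i) = Suc c}"
    proof
      fix k assume k: "k \<in> {k \<in> {1..p}. quantile b k = Suc c}"
      then have "k \<in> \<sigma> ` {1..p}"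
        unfolding bij_betw_imp_surj_on[OF \<sigma>] by simp
      with k show "k \<in> \<sigma> ` {i \<in> {1..p}. quantile b (\<sigma> i) = Suc c}"
        by blast
    qed
  next
    show "\<sigma> ` {i \<in> {1..p}. quantile b (\<sigma> i) = Suc c} \<subseteq> {k \<in> {1..p}. quantile b k = Suc c}"
      using bij_betw_apply[OF \<sigma>] by auto
  qed
  moreover have "inj_on \<sigma> {i \<in> {1..p}. quantile b (\<sigma> i) = Suc c}"
    by (rule inj_on_subset[OF bij_betw_imp_inj_on[OF \<sigma>]]) blast
  ultimately have "card {i \<in> {1..p}. quantile b (\<sigma> i) = Suc c}
      = card {k \<in> {1..p}. quantile b k = Suc c}"
    using card_image by fastforce
  also have "{k \<in> {1..p}. quantile b k = Suc c}
      = {k \<in> {1..p}. quantile b k \<le> Suc c \<and> \<not> quantile b k \<le> c}"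
    by auto
  also have "\<dots> = {k \<in> {1..p}. k \<le> sum_list (take (Suc c) b) \<and> \<not> k \<le> sum_list (take c b)}"
    by (intro Collect_cong conj_cong HOL.refl) (simp_all only: le)
  also have "\<dots> = {sum_list (take c b)<..sum_list (take (Suc c) b)}"
    using sum_list_take_mono[of "Suc c" "length b" b] c p by auto
  also have "card \<dots> = b ! c"
    using c by (simp add: take_Suc_conv_app_nth)
  finally show "level_counts p (length b) (\<lambda>i. quantile b (\<sigma> i)) ! c = b ! c"
    using c by (simp add: nth_level_counts)
qed simp

text \<open>
  Deleting zeros only removes repetitions from the partial sums. So refinement of flattened
  compositions can be tested on the original sequences.
\<close>

lemma partial_sums_flat:
  "range (\<lambda>k. sum_list (take k (flat b))) = range (\<lambda>k. sum_list (take k b))"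
proof (induction b)
  case (Cons x b)
  have step: "range (\<lambda>k. sum_list (take k (x # ys)))
      = insert 0 ((+) x ` range (\<lambda>k. sum_list (take k ys)))" for x :: nat and ys
  proof -
    have "UNIV = insert 0 (range Suc)"
      using not0_implies_Suc by blast
    then have "range (\<lambda>k. sum_list (take k (x # ys)))
        = (\<lambda>k. sum_list (take k (x # ys))) ` insert 0 (range Suc)"
      by (rule arg_cong)
    also have "\<dots> = insert 0 ((+) x ` range (\<lambda>k. sum_list (take k ys)))"
      by (simp only: image_insert image_image) simp
    finally show ?thesis .
  qed
  have zero: "0 \<in> range (\<lambda>k. sum_list (take k b))"
    by (rule image_eqI[of _ _ 0]) auto
  show ?case
  proof (cases "x = 0")
    case True
    then show ?thesis
      using Cons step[of 0 b] zero by (auto simp: flat_def insert_absorb)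
  next
    case False
    then have "flat (x # b) = x # flat b"
      by (simp add: flat_def)
    then show ?thesis
      using Cons by (simp only: step)
  qed
qed (simp add: flat_def)

lemma sum_list_flat [simp]: "sum_list (flat b) = sum_list b"
  by (induction b) (auto simp: flat_def)

lemma comp_refines_flat_iff:
  "comp_refines (flat b) (flat a) \<longleftrightarrow>
     sum_list b = sum_list a \<and>
     (\<forall>c. \<exists>d. sum_list (take c a) = sum_list (take d b))"
proof -
  have bounded: "(\<exists>k\<le>length xs. s = sum_list (take k xs)) \<longleftrightarrow> s \<in> range (\<lambda>k. sum_list (take k xs))"
    for s :: nat and xs
  proof
    assume "s \<in> range (\<lambda>k. sum_list (take k xs))"
    then obtain k where "s = sum_list (take k xs)"
      by blast
    then have "s = sum_list (take (min k (length xs)) xs)"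
      by (cases "k \<le> length xs") (auto simp: min_def)
    then show "\<exists>k\<le>length xs. s = sum_list (take k xs)"
      by (intro exI[of _ "min k (length xs)"]) simp
  qed auto
  have "(\<forall>j\<le>length (flat a). \<exists>k\<le>length (flat b).
          sum_list (take j (flat a)) = sum_list (take k (flat b)))
      \<longleftrightarrow> (\<forall>s. (\<exists>j\<le>length (flat a). s = sum_list (take j (flat a)))
            \<longrightarrow> (\<exists>k\<le>length (flat b). s = sum_list (take k (flat b))))"
    by (auto simp only:)
  also have "\<dots> \<longleftrightarrow> range (\<lambda>k. sum_list (take k a)) \<subseteq> range (\<lambda>k. sum_list (take k b))"
    by (simp only: bounded partial_sums_flat subset_iff)
  also have "\<dots> \<longleftrightarrow> (\<forall>c. \<exists>d. sum_list (take c a) = sum_list (take d b))"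
    by (simp add: image_subset_iff image_iff)
  finally show ?thesis
    by (simp add: comp_refines_def)
qed

lemma prod_Var_level_counts:
  assumes "f \<in> {1..p} \<rightarrow> {1..n}"
  shows "(\<Prod>i\<in>{1..p}. Var (f i)) = (\<Prod>c<n. Var (Suc c) ^ (level_counts p n f ! c))"
proof -
  have f: "f i - 1 < n" "Suc (f i - 1) = f i" if "i \<in> {1..p}" for i
    using funcset_interval_bounds[OF assms that] by simp_all
  have "(\<Prod>i\<in>{1..p}. Var (f i))
      = (\<Prod>c<n. \<Prod>i\<in>{i \<in> {1..p}. f i - 1 = c}. Var (f i))"
    by (rule prod.group[symmetric]) (use f in auto)
  also have "\<dots> = (\<Prod>c<n. Var (Suc c) ^ (level_counts p n f ! c))"
  proof (rule prod.cong)
    fix c assume "c \<in> {..<n}"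
    have "{i \<in> {1..p}. f i - 1 = c} = {i \<in> {1..p}. f i = Suc c}"
      using f(2) by force
    with \<open>c \<in> {..<n}\<close> show "(\<Prod>i\<in>{i \<in> {1..p}. f i - 1 = c}. Var (f i))
        = Var (Suc c) ^ (level_counts p n f ! c)"
      by (simp add: nth_level_counts)
  qed simp
  finally show ?thesis .
qed

section \<open>The tightened bound of a labeled poset\<close>

lemma descent_count_Cons:
  assumes "xs \<noteq> []"
  shows "descent_count (x # xs) = of_bool (x > hd xs) + descent_count xs"
proof -
  let ?D = "\<lambda>xs :: nat list. {t. Suc t < length xs \<and> xs ! t > xs ! Suc t}"
  have "t \<in> ?D (x # xs) \<longleftrightarrow> t \<in> (if x > hd xs then {0} else {}) \<union> Suc ` ?D xs" for t
    using assms by (cases t) (auto simp: hd_conv_nth)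
  then have "?D (x # xs) = (if x > hd xs then {0} else {}) \<union> Suc ` ?D xs"
    by blast
  moreover have "finite (?D xs)"
    by (rule finite_subset[of _ "{..<length xs}"]) auto
  moreover have "card (Suc ` ?D xs) = card (?D xs)"
    by (rule card_image) simp
  ultimately show ?thesis
    unfolding descent_count_def by (simp add: card_insert_if)
qed

locale labeled_poset =
  fixes p :: nat and P :: "nat rel"
  assumes partial: "partial_order_on {1..p} P"
begin

lemma in_carrier: "(i, j) \<in> P \<Longrightarrow> i \<in> {1..p} \<and> j \<in> {1..p}"
  using partial_order_onD(4)[OF partial] by blast

lemma refl: "i \<in> {1..p} \<Longrightarrow> (i, i) \<in> P"
  by (rule refl_onD[OF partial_order_onD(1)[OF partial]])

lemma trans: "(i, j) \<in> P \<Longrightarrow> (j, k) \<in> P \<Longrightarrow> (i, k) \<in> P"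
  by (rule transD[OF partial_order_onD(2)[OF partial]])

lemma antisym: "(i, j) \<in> P \<Longrightarrow> (j, i) \<in> P \<Longrightarrow> i = j"
  by (rule antisymD[OF partial_order_onD(3)[OF partial]])

lemma strictly_below_trans:
  "strictly_below P i j \<Longrightarrow> strictly_below P j k \<Longrightarrow> strictly_below P i k"
  unfolding strictly_below_def by (metis antisym trans)

lemma finite_chains_between:
  assumes "i \<in> {1..p}"
  shows "finite (chains_between P i j)"
proof (rule finite_subset)
  show "chains_between P i j \<subseteq> {xs. set xs \<subseteq> {1..p} \<and> distinct xs}"
  proof
    fix xs assume xs: "xs \<in> chains_between P i j"
    have "transp (strictly_below P)"
      using strictly_below_trans by (intro transpI)
    with xs have sorted: "sorted_wrt (strictly_below P) xs"
      by (auto simp: chains_between_def successively_conv_sorted_wrt)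
    have "distinct xs"
      using sorted by (induction xs) (auto simp: strictly_below_def)
    moreover from xs obtain ys where "xs = i # ys"
      by (cases xs) (auto simp: chains_between_def)
    with sorted have "set xs \<subseteq> {1..p}"
      using assms in_carrier by (fastforce simp: strictly_below_def)
    ultimately show "xs \<in> {xs. set xs \<subseteq> {1..p} \<and> distinct xs}"
      by simp
  qed
qed (simp add: finite_subset_distinct)

lemma descent_count_le_delta:
  assumes "i \<in> {1..p}" "xs \<in> chains_between P i j"
  shows "descent_count xs \<le> delta P i j"
  unfolding delta_def using assms finite_chains_between by (intro Max_ge) auto

text \<open>
  The maximum is attained because the set of chains is finite and contains the chain \<open>i, j\<close>,
  or \<open>i\<close> alone when \<open>i = j\<close>.
\<close>

lemma delta_attained:
  assumes "(i, j) \<in> P"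
  obtains xs where "xs \<in> chains_between P i j" "delta P i j = descent_count xs"
proof -
  have "(if i = j then [i] else [i, j]) \<in> chains_between P i j"
    using assms by (simp add: chains_between_def strictly_below_def)
  then have "descent_count ` chains_between P i j \<noteq> {}"
    by blast
  moreover have "finite (descent_count ` chains_between P i j)"
    using finite_chains_between in_carrier[OF assms] by blast
  ultimately have "delta P i j \<in> descent_count ` chains_between P i j"
    unfolding delta_def by (intro Max_in)
  then show ?thesis
    using that by blast
qed

lemma delta_prepend:
  assumes "strictly_below P i j" "(j, x) \<in> P"
  shows "delta P j x + of_bool (i > j) \<le> delta P i x"
proof -
  obtain xs where xs: "xs \<in> chains_between P j x" "delta P j x = descent_count xs"
    using delta_attained[OF assms(2)] .
  then have "i # xs \<in> chains_between P i x"
    using assms(1) by (auto simp: chains_between_def successively_Cons)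
  moreover have "i \<in> {1..p}"
    using assms(1) in_carrier by (auto simp: strictly_below_def)
  ultimately have "descent_count (i # xs) \<le> delta P i x"
    by (intro descent_count_le_delta)
  moreover have "descent_count (i # xs) = descent_count xs + of_bool (i > j)"
    using xs(1) by (subst descent_count_Cons) (auto simp: chains_between_def)
  ultimately show ?thesis
    by (simp add: xs(2))
qed

lemma finite_above: "finite {x. (i, x) \<in> P}"
  by (rule finite_subset[of _ "{1..p}"]) (use in_carrier in blast, simp)

lemma rho_bar_le:
  assumes "(i, x) \<in> P"
  shows "rho_bar P \<rho> i \<le> \<rho> x - int (delta P i x)"
  unfolding rho_bar_def using assms finite_above[of i] by (intro Min_le) auto

lemma rho_bar_greatest:
  assumes "i \<in> {1..p}" and "\<And>x. (i, x) \<in> P \<Longrightarrow> m \<le> \<rho> x - int (delta P i x)"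
  shows "m \<le> rho_bar P \<rho> i"
  unfolding rho_bar_def using assms refl[OF assms(1)] finite_above[of i]
  by (subst Min_ge_iff) auto

text \<open>
  By \<open>delta_prepend\<close>, each term \<open>\<rho> x - delta j x\<close> of the minimum for \<open>j\<close> is at least \<open>[i > j]\<close>
  larger than the term for \<open>i\<close> with the same \<open>x\<close>.
\<close>

lemma rho_bar_step:
  assumes "strictly_below P i j"
  shows "rho_bar P \<rho> i + of_bool (i > j) \<le> rho_bar P \<rho> j"
proof (rule rho_bar_greatest)
  show "j \<in> {1..p}"
    using assms in_carrier by (auto simp: strictly_below_def)
next
  fix x assume jx: "(j, x) \<in> P"
  then have "(i, x) \<in> P"
    using assms trans by (auto simp: strictly_below_def)
  from rho_bar_le[OF this, of \<rho>] delta_prepend[OF assms jx]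
  show "rho_bar P \<rho> i + of_bool (i > j) \<le> \<rho> x - int (delta P j x)"
    by (cases "i > j") auto
qed

lemma descent_count_le_increase:
  fixes f :: "nat \<Rightarrow> nat"
  assumes weak: "\<And>i j. strictly_below P i j \<Longrightarrow> f i \<le> f j"
    and strict: "\<And>i j. strictly_below P i j \<Longrightarrow> i > j \<Longrightarrow> f i < f j"
    and "successively (strictly_below P) xs" "xs \<noteq> []"
  shows "f (hd xs) + descent_count xs \<le> f (last xs)"
  using assms(3,4)
proof (induction xs)
  case (Cons i xs)
  show ?case
  proof (cases "xs = []")
    case True
    then show ?thesis
      by (simp add: descent_count_def)
  next
    case False
    with Cons.prems have below: "strictly_below P i (hd xs)"
      and "successively (strictly_below P) xs"
      by (simp_all add: successively_Cons)
    with Cons.IH False have "f (hd xs) + descent_count xs \<le> f (last xs)"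
      by simp
    with weak[OF below] strict[OF below] show ?thesis
      using False by (auto simp: descent_count_Cons)
  qed
qed simp

text \<open>
  Along a chain from \<open>i\<close> to \<open>x\<close> with the most descents, \<open>f\<close> climbs by at least \<open>delta i x\<close>,
  and it ends at most at \<open>\<rho> x\<close>.
\<close>

lemma bounded_partition_le_rho_bar:
  assumes f: "f \<in> bounded_partitions p P \<rho>" and i: "i \<in> {1..p}"
  shows "int (f i) \<le> rho_bar P \<rho> i"
proof (rule rho_bar_greatest[OF i])
  fix x assume ix: "(i, x) \<in> P"
  then obtain xs where xs: "xs \<in> chains_between P i x" "delta P i x = descent_count xs"
    by (rule delta_attained)
  have "f (hd xs) + descent_count xs \<le> f (last xs)"
    by (rule descent_count_le_increase) (use f xs(1) in \<open>auto simp: bounded_partitions_def chains_between_def\<close>)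
  moreover have "int (f x) \<le> \<rho> x"
    using f in_carrier[OF ix] by (simp add: bounded_partitions_def)
  ultimately show "int (f i) \<le> \<rho> x - int (delta P i x)"
    using xs by (simp add: chains_between_def)
qed

lemma bounded_partitions_rho_bar:
  "bounded_partitions p P (rho_bar P \<rho>) = bounded_partitions p P \<rho>"
proof -
  have "rho_bar P \<rho> i \<le> \<rho> i" if "i \<in> {1..p}" for i
    using rho_bar_le[OF refl[OF that], of \<rho>] by simp
  then have "f \<in> bounded_partitions p P \<rho>" if "f \<in> bounded_partitions p P (rho_bar P \<rho>)" for f
    using that unfolding bounded_partitions_def by (fastforce intro: order_trans)
  moreover have "f \<in> bounded_partitions p P (rho_bar P \<rho>)" if "f \<in> bounded_partitions p P \<rho>" for f
    using that bounded_partition_le_rho_bar[OF that] by (simp add: bounded_partitions_def)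
  ultimately show ?thesis
    by blast
qed

end

section \<open>Slide polynomials as sums over order-preserving maps\<close>

locale labeled_chain = labeled_poset p L for p L +
  assumes total_on_carrier: "total_on {1..p} L"
begin

lemma total: "i \<in> {1..p} \<Longrightarrow> j \<in> {1..p} \<Longrightarrow> (i, j) \<in> L \<or> (j, i) \<in> L"
  using total_on_carrier refl by (cases "i = j") (auto simp: total_on_def)

definition rank :: "nat \<Rightarrow> nat" where
  "rank i = card {j. (j, i) \<in> L}"

lemma finite_below: "finite {j. (j, i) \<in> L}"
  by (rule finite_subset[of _ "{1..p}"]) (use in_carrier in blast, simp)

lemma rank_le_iff:
  assumes "i \<in> {1..p}" "j \<in> {1..p}"
  shows "rank i \<le> rank j \<longleftrightarrow> (i, j) \<in> L"
proof
  assume "(i, j) \<in> L"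
  then show "rank i \<le> rank j"
    unfolding rank_def by (intro card_mono finite_below) (auto intro: trans)
next
  assume le: "rank i \<le> rank j"
  show "(i, j) \<in> L"
  proof (rule ccontr)
    assume nle: "(i, j) \<notin> L"
    with assms total have "(j, i) \<in> L"
      by blast
    then have "{k. (k, j) \<in> L} \<subset> {k. (k, i) \<in> L}"
      using refl[OF assms(1)] nle by (auto intro: trans)
    then have "rank j < rank i"
      unfolding rank_def by (rule psubset_card_mono[OF finite_below])
    with le show False
      by simp
  qed
qed

lemma bij_betw_rank: "bij_betw rank {1..p} {1..p}"
proof -
  have "inj_on rank {1..p}"
    by (rule inj_onI) (metis antisym le_refl rank_le_iff)
  moreover have "rank ` {1..p} \<subseteq> {1..p}"
  proof
    fix k assume "k \<in> rank ` {1..p}"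
    then obtain i where i: "i \<in> {1..p}" "k = rank i"
      by blast
    have "{j. (j, i) \<in> L} \<subseteq> {1..p}"
      using in_carrier by blast
    then have "rank i \<le> p"
      using card_mono[of "{1..p}" "{j. (j, i) \<in> L}"] by (simp add: rank_def)
    moreover have "rank i \<noteq> 0"
      using refl[OF i(1)] finite_below[of i] by (auto simp: rank_def)
    ultimately show "k \<in> {1..p}"
      using i by simp
  qed
  ultimately show ?thesis
    by (simp add: bij_betw_def endo_inj_surj)
qed

lemma rank_in_range: "i \<in> {1..p} \<Longrightarrow> rank i \<in> {1..p}"
  using bij_betw_rank bij_betwE by blast

text \<open>
  The elements with \<open>f j \<le> c\<close> form a down-set, hence an initial segment of the linear order, and
  such a segment is determined by its size. This is how the level sizes of \<open>f\<close> know all of \<open>f\<close>,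
  and it has the same form as \<open>quantile_le_iff\<close>.
\<close>

lemma le_iff_rank_le_card:
  fixes f :: "nat \<Rightarrow> nat"
  assumes mono: "\<And>i j. (i, j) \<in> L \<Longrightarrow> f i \<le> f j" and i: "i \<in> {1..p}"
  shows "f i \<le> c \<longleftrightarrow> rank i \<le> card {j \<in> {1..p}. f j \<le> c}"
proof
  assume "f i \<le> c"
  then have "f j \<le> c" if "(j, i) \<in> L" for j
    using mono[OF that] by simp
  then have "{j. (j, i) \<in> L} \<subseteq> {j \<in> {1..p}. f j \<le> c}"
    using in_carrier by blast
  then show "rank i \<le> card {j \<in> {1..p}. f j \<le> c}"
    unfolding rank_def by (intro card_mono) auto
next
  assume le: "rank i \<le> card {j \<in> {1..p}. f j \<le> c}"
  show "f i \<le> c"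
  proof (rule ccontr)
    assume gt: "\<not> f i \<le> c"
    have "(j, i) \<in> L" if "j \<in> {1..p}" "f j \<le> c" for j
      using total[OF i that(1)] mono[of i j] that gt by auto
    moreover have "(i, i) \<in> L"
      by (rule refl[OF i])
    ultimately have "{j \<in> {1..p}. f j \<le> c} \<subset> {j. (j, i) \<in> L}"
      using gt by blast
    then have "card {j \<in> {1..p}. f j \<le> c} < rank i"
      unfolding rank_def by (rule psubset_card_mono[OF finite_below])
    with le show False
      by simp
  qed
qed

text \<open>
  Domination compares the sizes of the initial segments \<open>{f \<le> c}\<close> and \<open>{r \<le> c}\<close>; initial segments
  are nested, so this amounts to \<open>{r \<le> c} \<subseteq> {f \<le> c}\<close> for every \<open>c\<close>.
\<close>

lemma dominates_level_counts_iff: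
  assumes f: "f \<in> {1..p} \<rightarrow> {1..n}" and f_mono: "\<And>i j. (i, j) \<in> L \<Longrightarrow> f i \<le> f j"
    and r: "r \<in> {1..p} \<rightarrow> {1..n}" and r_mono: "\<And>i j. (i, j) \<in> L \<Longrightarrow> r i \<le> r j"
  shows "dominates (level_counts p n f) (level_counts p n r) \<longleftrightarrow> (\<forall>i\<in>{1..p}. f i \<le> r i)"
proof
  assume "dominates (level_counts p n f) (level_counts p n r)"
  then have dom: "card {j \<in> {1..p}. r j \<le> c} \<le> card {j \<in> {1..p}. f j \<le> c}" for c
    by (simp only: dominates_def sum_list_take_level_counts[OF f] sum_list_take_level_counts[OF r])
  show "\<forall>i\<in>{1..p}. f i \<le> r i"
  proof
    fix i assume i: "i \<in> {1..p}"
    have "rank i \<le> card {j \<in> {1..p}. r j \<le> r i}"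
      using le_iff_rank_le_card[where f = r, OF r_mono i] by blast
    then have "rank i \<le> card {j \<in> {1..p}. f j \<le> r i}"
      by (rule order.trans[OF _ dom])
    then show "f i \<le> r i"
      using le_iff_rank_le_card[where f = f, OF f_mono i] by blast
  qed
next
  assume le: "\<forall>i\<in>{1..p}. f i \<le> r i"
  have "card {j \<in> {1..p}. r j \<le> c} \<le> card {j \<in> {1..p}. f j \<le> c}" for c
    by (rule card_mono) (use le in force)+
  then show "dominates (level_counts p n f) (level_counts p n r)"
    by (simp only: dominates_def sum_list_take_level_counts[OF f] sum_list_take_level_counts[OF r])
      blast
qed

text \<open>
  Refinement says that every initial segment \<open>{r \<le> c}\<close> is also of the form \<open>{f \<le> d}\<close>, that is,
  \<open>f\<close> separates whatever \<open>r\<close> separates.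
\<close>

lemma refines_level_counts_iff:
  assumes f: "f \<in> {1..p} \<rightarrow> {1..n}" and f_mono: "\<And>i j. (i, j) \<in> L \<Longrightarrow> f i \<le> f j"
    and r: "r \<in> {1..p} \<rightarrow> {1..n}" and r_mono: "\<And>i j. (i, j) \<in> L \<Longrightarrow> r i \<le> r j"
  shows "comp_refines (flat (level_counts p n f)) (flat (level_counts p n r)) \<longleftrightarrow>
    (\<forall>i\<in>{1..p}. \<forall>j\<in>{1..p}. r i < r j \<longrightarrow> f i < f j)"
proof -
  let ?A = "\<lambda>c. card {j \<in> {1..p}. r j \<le> c}" and ?B = "\<lambda>c. card {j \<in> {1..p}. f j \<le> c}"
  have A: "r i \<le> c \<longleftrightarrow> rank i \<le> ?A c" and B: "f i \<le> c \<longleftrightarrow> rank i \<le> ?B c" if "i \<in> {1..p}" for i c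
    using le_iff_rank_le_card[where f = r, OF r_mono that]
      le_iff_rank_le_card[where f = f, OF f_mono that] by blast+
  have "(\<forall>c. \<exists>d. ?A c = ?B d) \<longleftrightarrow> (\<forall>i\<in>{1..p}. \<forall>j\<in>{1..p}. r i < r j \<longrightarrow> f i < f j)"
  proof
    assume sums: "\<forall>c. \<exists>d. ?A c = ?B d"
    show "\<forall>i\<in>{1..p}. \<forall>j\<in>{1..p}. r i < r j \<longrightarrow> f i < f j"
    proof (intro ballI impI)
      fix i j assume i: "i \<in> {1..p}" and j: "j \<in> {1..p}" and less: "r i < r j"
      obtain d where "?A (r i) = ?B d"
        using sums by blast
      then have "f i \<le> d" "\<not> f j \<le> d"
        using A[OF i, of "r i"] A[OF j, of "r i"] B[OF i, of d] B[OF j, of d] less by auto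
      then show "f i < f j"
        by simp
    qed
  next
    assume strict: "\<forall>i\<in>{1..p}. \<forall>j\<in>{1..p}. r i < r j \<longrightarrow> f i < f j"
    show "\<forall>c. \<exists>d. ?A c = ?B d"
    proof
      fix c
      show "\<exists>d. ?A c = ?B d"
      proof (cases "?A c = 0")
        case True
        moreover have "{j \<in> {1..p}. f j \<le> 0} = {}"
          using funcset_interval_bounds(1)[OF f] by fastforce
        ultimately have "?A c = ?B 0"
          by (simp only: card.empty)
        then show ?thesis ..
      next
        case False
        have "?A c \<le> p"
          using card_mono[of "{1..p}" "{j \<in> {1..p}. r j \<le> c}"] by fastforce
        with False have "?A c \<in> {1..p}"
          unfolding atLeastAtMost_iff by linarith
        then have "?A c \<in> rank ` {1..p}"
          by (simp only: bij_betw_imp_surj_on[OF bij_betw_rank])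
        \<comment> \<open>The top element \<open>i\<close> of the segment \<open>{r \<le> c}\<close>; the cut to use for \<open>f\<close> is \<open>d = f i\<close>.\<close>
        then obtain i where i: "i \<in> {1..p}" "rank i = ?A c"
          by force
        have "r j \<le> c \<longleftrightarrow> f j \<le> f i" if j: "j \<in> {1..p}" for j
        proof
          assume "r j \<le> c"
          then have "(j, i) \<in> L"
            using A[OF j, of c] i rank_le_iff[OF j i(1)] by simp
          then show "f j \<le> f i"
            by (rule f_mono)
        next
          assume le: "f j \<le> f i"
          show "r j \<le> c"
          proof (rule ccontr)
            assume "\<not> r j \<le> c"
            moreover have "r i \<le> c"
              using A[OF i(1), of c] i by simp
            ultimately have "f i < f j"
              using strict i(1) j by auto
            with le show False
              by simp
          qed
        qed
        then have "{j \<in> {1..p}. r j \<le> c} = {j \<in> {1..p}. f j \<le> f i}"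
          by blast
        then show ?thesis
          by metis
      qed
    qed
  qed
  then show ?thesis
    unfolding comp_refines_flat_iff
    by (simp only: sum_list_take_level_counts[OF f] sum_list_take_level_counts[OF r]
        sum_list_level_counts[OF f] sum_list_level_counts[OF r] simp_thms)
qed

text \<open>
  The bounded partitions for the bound \<open>r\<close>, except that strictness is demanded where \<open>r\<close> increases
  instead of at descents of the labels. The labels have disappeared, as they do not occur in
  a slide polynomial.
\<close>

definition staircase_maps :: "(nat \<Rightarrow> nat) \<Rightarrow> (nat \<Rightarrow> nat) set" where
  "staircase_maps r = {f \<in> {1..p} \<rightarrow>\<^sub>E {1..}.
     (\<forall>i j. (i, j) \<in> L \<longrightarrow> f i \<le> f j) \<and>
     (\<forall>i\<in>{1..p}. \<forall>j\<in>{1..p}. r i < r j \<longrightarrow> f i < f j) \<and>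
     (\<forall>i\<in>{1..p}. f i \<le> r i)}"

lemma staircase_maps_range:
  assumes r: "r \<in> {1..p} \<rightarrow> {1..n}" and f: "f \<in> staircase_maps r"
  shows "f \<in> {1..p} \<rightarrow> {1..n}"
proof
  fix i assume i: "i \<in> {1..p}"
  have "1 \<le> f i" "f i \<le> r i"
    using f i by (auto simp: staircase_maps_def PiE_iff)
  with funcset_interval_bounds(2)[OF r i] show "f i \<in> {1..n}"
    by simp
qed

lemma bij_betw_level_counts:
  assumes r: "r \<in> {1..p} \<rightarrow> {1..n}" and r_mono: "\<And>i j. (i, j) \<in> L \<Longrightarrow> r i \<le> r j"
  defines "a \<equiv> level_counts p n r"
  shows "bij_betw (level_counts p n) (staircase_maps r)
    {b. length b = length a \<and> dominates b a \<and> comp_refines (flat b) (flat a)}"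
    (is "bij_betw _ _ ?B")
proof (rule bij_betw_byWitness)
  let ?inv = "\<lambda>b. restrict (\<lambda>i. quantile b (rank i)) {1..p}"
  note range = staircase_maps_range[OF r]
  show "\<forall>f\<in>staircase_maps r. ?inv (level_counts p n f) = f"
  proof (intro ballI ext)
    fix f i assume f: "f \<in> staircase_maps r"
    then have f_mono: "\<And>i j. (i, j) \<in> L \<Longrightarrow> f i \<le> f j"
      by (simp add: staircase_maps_def)
    show "?inv (level_counts p n f) i = f i"
    proof (cases "i \<in> {1..p}")
      case True
      have "quantile (level_counts p n f) (rank i) \<le> c \<longleftrightarrow> f i \<le> c" for c
        using quantile_le_iff[of "rank i" "level_counts p n f" c] rank_in_range[OF True]
          le_iff_rank_le_card[where f = f, OF f_mono True, of c]
        by (simp add: sum_list_level_counts[OF range[OF f]]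
            sum_list_take_level_counts[OF range[OF f]])
      then show ?thesis
        using True by (metis le_antisym order_refl restrict_apply')
    next
      case False
      with f show ?thesis
        by (auto simp: staircase_maps_def PiE_iff extensional_def)
    qed
  qed
  have surj: "level_counts p n (?inv b) = b" "?inv b \<in> staircase_maps r" if "b \<in> ?B" for b
  proof -
    have len: "length b = n" and sum: "p = sum_list b"
      using that sum_list_level_counts[OF r] by (auto simp: a_def comp_refines_flat_iff)
    have "level_counts p n (?inv b) = level_counts p n (\<lambda>i. quantile b (rank i))"
      by (rule level_counts_cong) simp
    with level_counts_quantile[OF bij_betw_rank sum]
    show inv: "level_counts p n (?inv b) = b"
      by (simp add: len)
    have inv_range: "?inv b \<in> {1..p} \<rightarrow> {1..n}"
    proof (rule funcsetI)
      fix i assume i: "i \<in> {1..p}"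
      have "rank i \<in> {1..sum_list b}"
        using rank_in_range[OF i] sum by simp
      from quantile_in_range[OF this] i show "?inv b i \<in> {1..n}"
        by (simp add: len)
    qed
    have inv_mono: "?inv b i \<le> ?inv b j" if "(i, j) \<in> L" for i j
      using that in_carrier[OF that] rank_le_iff[of i j] rank_in_range[of j] sum
      by (auto intro: quantile_mono)
    have "dominates b a" and "comp_refines (flat b) (flat a)"
      using that by blast+
    then have "\<forall>i\<in>{1..p}. ?inv b i \<le> r i"
      and "\<forall>i\<in>{1..p}. \<forall>j\<in>{1..p}. r i < r j \<longrightarrow> ?inv b i < ?inv b j"
      using dominates_level_counts_iff[OF inv_range inv_mono r r_mono]
        refines_level_counts_iff[OF inv_range inv_mono r r_mono]
      unfolding inv a_def by (simp_all only:)
    moreover have "?inv b \<in> {1..p} \<rightarrow>\<^sub>E {1..}"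
      using funcset_interval_bounds(1)[OF inv_range] by (simp add: PiE_iff)
    ultimately show "?inv b \<in> staircase_maps r"
      unfolding staircase_maps_def by (intro CollectI conjI allI impI inv_mono)
  qed
  show "\<forall>b\<in>?B. level_counts p n (?inv b) = b"
    using surj(1) by (rule ballI)
  show "?inv ` ?B \<subseteq> staircase_maps r"
    using surj(2) by (rule image_subsetI)
  show "level_counts p n ` staircase_maps r \<subseteq> ?B"
  proof
    fix b assume "b \<in> level_counts p n ` staircase_maps r"
    then obtain f where f: "f \<in> staircase_maps r" and b: "b = level_counts p n f"
      by blast
    then have f_mono: "\<And>i j. (i, j) \<in> L \<Longrightarrow> f i \<le> f j"
      by (simp add: staircase_maps_def)
    show "b \<in> ?B"
      using dominates_level_counts_iff[OF range[OF f] f_mono r r_mono]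
        refines_level_counts_iff[OF range[OF f] f_mono r r_mono] f
      by (simp add: b a_def staircase_maps_def)
  qed
qed

lemma slide_poly_level_counts:
  assumes r: "r \<in> {1..p} \<rightarrow> {1..n}" and r_mono: "\<And>i j. (i, j) \<in> L \<Longrightarrow> r i \<le> r j"
  shows "slide_poly (level_counts p n r) = (\<Sum>f\<in>staircase_maps r. \<Prod>i\<in>{1..p}. Var (f i))"
proof -
  have "(\<Sum>f\<in>staircase_maps r. \<Prod>i\<in>{1..p}. Var (f i))
      = (\<Sum>f\<in>staircase_maps r. \<Prod>c<n. Var (Suc c) ^ (level_counts p n f ! c))"
    by (intro sum.cong HOL.refl prod_Var_level_counts staircase_maps_range[OF r])
  also have "\<dots> = slide_poly (level_counts p n r)"
    unfolding slide_poly_def length_level_counts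
    using sum.reindex_bij_betw[OF bij_betw_level_counts[OF r r_mono],
        of "\<lambda>b. \<Prod>c<n. Var (Suc c) ^ (b ! c)"]
    by simp
  finally show ?thesis
    by (rule sym)
qed

end

section \<open>The chains left by deleting edges\<close>

lemma equiv_components: "equiv UNIV ((E \<union> E\<inverse>)\<^sup>*)"
proof (rule equivI)
  show "sym ((E \<union> E\<inverse>)\<^sup>*)"
    by (intro sym_rtrancl) (auto simp: sym_def)
qed (auto simp: refl_rtrancl trans_rtrancl)

lemma finite_components: "finite (components p E)"
  unfolding components_def quotient_def by simp

lemma in_some_component:
  assumes "i \<in> {1..p}"
  obtains C where "C \<in> components p E" "i \<in> C"
proof
  show "(E \<union> E\<inverse>)\<^sup>* `` {i} \<in> components p E"
    unfolding components_def by (rule quotientI[OF assms])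
qed simp

lemma component_nonempty: "C \<in> components p E \<Longrightarrow> C \<noteq> {}"
  by (auto simp: components_def quotient_def)

lemma component_subset:
  assumes E: "E \<subseteq> {1..p} \<times> {1..p}" and C: "C \<in> components p E"
  shows "C \<subseteq> {1..p}"
proof
  fix j assume "j \<in> C"
  with C obtain i where i: "i \<in> {1..p}" and "(i, j) \<in> (E \<union> E\<inverse>)\<^sup>*"
    by (auto simp: components_def quotient_def)
  from this(2) show "j \<in> {1..p}"
    by (induction) (use i E in auto)
qed

lemma component_closed:
  assumes "C \<in> components p E" "i \<in> C" "(i, j) \<in> E \<or> (j, i) \<in> E"
  shows "j \<in> C"
  using assms by (auto simp: components_def quotient_def intro: rtrancl_into_rtrancl)

lemma constant_on_component:
  assumes const: "\<And>i j. (i, j) \<in> E \<Longrightarrow> r i = r j"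
    and C: "C \<in> components p E" "i \<in> C" "j \<in> C"
  shows "r i = r j"
proof -
  obtain k where k: "C = (E \<union> E\<inverse>)\<^sup>* `` {k}"
    using C(1) by (auto simp: components_def quotient_def)
  have "r l = r k" if "(k, l) \<in> (E \<union> E\<inverse>)\<^sup>*" for l
    using that
  proof (induction)
    case (step l m)
    then show ?case
      using const[of l m] const[of m l] by auto
  qed simp
  from this[of i] this[of j] show ?thesis
    using C(2,3) k by simp
qed

lemma components_disjoint: "pairwise disjnt (components p E)"
proof (rule pairwiseI)
  fix C D assume C: "C \<in> components p E" and D: "D \<in> components p E" and "C \<noteq> D"
  have "C \<in> UNIV // (E \<union> E\<inverse>)\<^sup>*" "D \<in> UNIV // (E \<union> E\<inverse>)\<^sup>*"
    using C D by (auto simp: components_def quotient_def)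
  from quotient_disj[OF equiv_components this] \<open>C \<noteq> D\<close> show "disjnt C D"
    by (simp add: disjnt_def)
qed

text \<open>
  Weak compositions that agree up to trailing zeros are best compared through \<open>nth_default 0\<close>,
  which does not see where the list ends.
\<close>

lemma nth_default_chains_to_comp:
  assumes "finite \<C>"
  shows "nth_default 0 (chains_to_comp L \<rho> \<C>) c = (\<Sum>C\<in>{C \<in> \<C>. chain_pos L \<rho> C = Suc c}. card C)"
proof -
  let ?M = "Max (insert 0 (chain_pos L \<rho> ` \<C>))"
  show ?thesis
  proof (cases "c < ?M")
    case True
    then show ?thesis
      by (simp add: nth_default_def chains_to_comp_def nth_upt del: upt_Suc)
  next
    case False
    have "chain_pos L \<rho> C \<le> ?M" if "C \<in> \<C>" for C
      using assms that by (intro Max_ge) auto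
    with False have none: "{C \<in> \<C>. chain_pos L \<rho> C = Suc c} = {}"
      by fastforce
    from False have "nth_default 0 (chains_to_comp L \<rho> \<C>) c = 0"
      by (simp add: nth_default_def chains_to_comp_def del: upt_Suc)
    then show ?thesis
      by (simp only: none sum.empty)
  qed
qed

lemma same_weak_comp_nth_default:
  assumes "same_weak_comp a b"
  shows "nth_default 0 a c = nth_default 0 b c"
proof -
  have strip: "nth_default 0 (strip_while (\<lambda>x. x = 0) xs) c = nth_default 0 xs c" for xs :: "nat list"
  proof -
    obtain ys zs where "strip_while (\<lambda>x. x = 0) xs = ys" "\<forall>x\<in>set zs. x = 0" "xs = ys @ zs"
      by (rule split_strip_while_append)
    then show ?thesis
      by (simp add: nth_default_append) (simp add: nth_default_def)
  qed
  show ?thesis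
    using assms strip[of a] strip[of b] by (simp add: same_weak_comp_def)
qed

context labeled_chain
begin

lemma min_of_spec:
  assumes "C \<subseteq> {1..p}" "C \<noteq> {}"
  shows "min_of L C \<in> C \<and> (\<forall>x\<in>C. (min_of L C, x) \<in> L)"
  unfolding min_of_def
proof (rule theI')
  obtain m where m: "m \<in> C" "\<forall>x. x \<in> C \<longrightarrow> rank m \<le> rank x"
    using ex_has_least_nat[of "\<lambda>x. x \<in> C" _ rank] assms(2) by blast
  then have "\<forall>x\<in>C. (m, x) \<in> L"
    using rank_le_iff assms(1) by blast
  with m(1) show "\<exists>!m. m \<in> C \<and> (\<forall>x\<in>C. (m, x) \<in> L)"
    using antisym by blast
qed

lemma covered_byD:
  assumes "covered_by L i j"
  shows "(i, j) \<in> L" "i \<noteq> j" "i \<in> {1..p}" "j \<in> {1..p}" "strictly_below L i j"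
  using assms in_carrier by (auto simp: covered_by_def strictly_below_def)

lemma below_cover:
  assumes "covered_by L i j" "strictly_below L k j"
  shows "(k, i) \<in> L"
proof (rule ccontr)
  assume "(k, i) \<notin> L"
  moreover have "k \<in> {1..p}"
    using assms(2) in_carrier by (auto simp: strictly_below_def)
  ultimately have "strictly_below L i k"
    using total[of i k] refl covered_byD(3)[OF assms(1)] by (auto simp: strictly_below_def)
  with assms show False
    by (auto simp: covered_by_def)
qed

lemma obtain_predecessor:
  assumes "strictly_below L i j"
  obtains k where "(i, k) \<in> L" "covered_by L k j"
proof -
  have bound: "\<forall>k. (i, k) \<in> L \<and> strictly_below L k j \<longrightarrow> rank k < Suc p"
    using rank_in_range in_carrier by (auto simp: less_Suc_eq_le)
  have "(i, i) \<in> L"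
    using assms in_carrier refl by (auto simp: strictly_below_def)
  then obtain k where k: "(i, k) \<in> L" "strictly_below L k j"
    and last: "\<forall>l. (i, l) \<in> L \<and> strictly_below L l j \<longrightarrow> rank l \<le> rank k"
    using ex_has_greatest_nat[OF _ bound, of i] assms by blast
  have False if "strictly_below L k l" "strictly_below L l j" for l
  proof -
    have kl: "(k, l) \<in> L" "k \<noteq> l"
      using that(1) by (simp_all add: strictly_below_def)
    then have "(i, l) \<in> L"
      using trans[OF k(1)] by blast
    with last that(2) have "rank l \<le> rank k"
      by blast
    then have "(l, k) \<in> L"
      using in_carrier[OF kl(1)] rank_le_iff by blast
    with kl antisym show False
      by blast
  qed
  then have "covered_by L k j"
    using k(2) unfolding covered_by_def by blast
  with k(1) show ?thesis
    by (rule that)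
qed

text \<open>
  Staircase maps are strict at descents because \<open>r\<close> increases there. For the converse
  inclusion, an increase of \<open>r\<close> between \<open>i\<close> and \<open>j\<close> has to happen across some cover in between,
  and by the last assumption that cover is a descent.
\<close>

lemma bounded_partitions_eq_staircase_maps:
  assumes mono: "\<And>i j. (i, j) \<in> L \<Longrightarrow> r i \<le> r j"
    and descent: "\<And>i j. strictly_below L i j \<Longrightarrow> i > j \<Longrightarrow> r i < r j"
    and ascent: "\<And>i j. covered_by L i j \<Longrightarrow> i < j \<Longrightarrow> r i = r j"
  shows "bounded_partitions p L (\<lambda>i. int (r i)) = staircase_maps r"
proof (intro equalityI subsetI)
  fix f assume f: "f \<in> bounded_partitions p L (\<lambda>i. int (r i))"
  have f_mono: "f i \<le> f j" if "(i, j) \<in> L" for i j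
    using f that by (cases "i = j") (auto simp: bounded_partitions_def strictly_below_def)
  have "f i < f j" if i: "i \<in> {1..p}" and j: "j \<in> {1..p}" and less: "r i < r j" for i j
  proof -
    \<comment> \<open>\<open>l\<close> is the first element at which \<open>r\<close> exceeds \<open>r i\<close>, so \<open>r\<close> increases from its predecessor
      \<open>k\<close> to \<open>l\<close>.\<close>
    obtain l where l: "l \<in> {1..p} \<and> r i < r l"
      and first: "\<forall>x. x \<in> {1..p} \<and> r i < r x \<longrightarrow> rank l \<le> rank x"
      using ex_has_least_nat[of "\<lambda>x. x \<in> {1..p} \<and> r i < r x" j rank] j less by blast
    have "(i, l) \<in> L" "i \<noteq> l"
      using total[OF i, of l] l mono[of l i] by auto
    then obtain k where k: "(i, k) \<in> L" "covered_by L k l"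
      using obtain_predecessor[of i l] by (auto simp: strictly_below_def)
    note kl = covered_byD[OF k(2)]
    have "\<not> r i < r k"
    proof
      assume "r i < r k"
      with first kl(3) have "rank l \<le> rank k"
        by blast
      then have "(l, k) \<in> L"
        using rank_le_iff kl(3,4) by blast
      with kl(1,2) antisym show False
        by blast
    qed
    then have "r k < r l"
      using l by simp
    then have "k > l"
      using ascent[OF k(2)] kl(2) by (cases "k < l") auto
    then have "f k < f l"
      using f kl(5) by (simp add: bounded_partitions_def)
    moreover have "f i \<le> f k"
      by (rule f_mono[OF k(1)])
    moreover have "rank l \<le> rank j"
      using first j less by blast
    then have "f l \<le> f j"
      using f_mono rank_le_iff l j by blast
    ultimately show "f i < f j"
      by simp
  qed
  moreover have "f \<in> {1..p} \<rightarrow>\<^sub>E {1..}" and "\<forall>i\<in>{1..p}. f i \<le> r i"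
    using f by (simp_all add: bounded_partitions_def)
  ultimately show "f \<in> staircase_maps r"
    unfolding staircase_maps_def by (intro CollectI conjI allI impI ballI f_mono) simp_all
next
  fix f assume f: "f \<in> staircase_maps r"
  have "f i < f j" if "strictly_below L i j" "i > j" for i j
  proof -
    have "i \<in> {1..p}" "j \<in> {1..p}"
      using that(1) in_carrier by (auto simp: strictly_below_def)
    with f descent[OF that] show ?thesis
      unfolding staircase_maps_def by blast
  qed
  moreover have "f i \<le> f j" if "strictly_below L i j" for i j
    using f that by (simp add: staircase_maps_def strictly_below_def)
  moreover have "f \<in> {1..p} \<rightarrow>\<^sub>E {1..}" and "\<forall>i\<in>{1..p}. int (f i) \<le> int (r i)"
    using f by (simp_all add: staircase_maps_def)
  ultimately show "f \<in> bounded_partitions p L (\<lambda>i. int (r i))"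
    unfolding bounded_partitions_def by (intro CollectI conjI allI impI) simp_all
qed

end

section \<open>The two compositions of a bounded linear order\<close>

locale bounded_chain = labeled_chain +
  fixes \<rho> :: "nat \<Rightarrow> int"
  assumes rho_bar_pos: "i \<in> {1..p} \<Longrightarrow> rho_bar L \<rho> i \<ge> 1"
begin

definition bound :: "nat \<Rightarrow> nat" where
  "bound i = nat (rho_bar L \<rho> i)"

lemma int_bound: "i \<in> {1..p} \<Longrightarrow> int (bound i) = rho_bar L \<rho> i"
  using rho_bar_pos[of i] by (simp add: bound_def)

lemma bound_descent:
  assumes "strictly_below L i j" "i > j"
  shows "bound i < bound j"
proof -
  have "i \<in> {1..p}" "j \<in> {1..p}"
    using assms(1) in_carrier by (auto simp: strictly_below_def)
  with rho_bar_step[OF assms(1), of \<rho>] assms(2) show ?thesis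
    by (simp flip: int_bound)
qed

lemma bound_mono:
  assumes "(i, j) \<in> L"
  shows "bound i \<le> bound j"
proof (cases "i = j")
  case False
  with assms rho_bar_step[of i j \<rho>] have "rho_bar L \<rho> i \<le> rho_bar L \<rho> j"
    by (cases "i > j") (simp_all add: strictly_below_def)
  then show ?thesis
    by (simp add: bound_def)
qed simp

definition red_edges :: "nat rel" where
  "red_edges = {(i, j). covered_by L i j \<and> \<not> i > j}"

definition des_edges :: "nat rel" where
  "des_edges = {(i, j). covered_by L i j \<and> \<not> rho_bar L \<rho> i < rho_bar L \<rho> j}"

lemma red_edges_carrier: "red_edges \<subseteq> {1..p} \<times> {1..p}"
  using covered_byD unfolding red_edges_def by blast

lemma des_edges_carrier: "des_edges \<subseteq> {1..p} \<times> {1..p}"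
  using covered_byD unfolding des_edges_def by blast

lemma bound_des_edge:
  assumes "(i, j) \<in> des_edges"
  shows "bound i = bound j"
proof -
  have cover: "covered_by L i j" and le: "rho_bar L \<rho> j \<le> rho_bar L \<rho> i"
    using assms by (auto simp: des_edges_def)
  from le have "bound j \<le> bound i"
    by (simp add: bound_def)
  with bound_mono[OF covered_byD(1)[OF cover]] show ?thesis
    by simp
qed

text \<open>
  Since \<open>bound\<close> may vary on a chain of \<open>red\<close>, only its value at the least element enters here.
\<close>

lemma nth_default_red:
  "nth_default 0 (red p L \<rho>) c
    = (\<Sum>C\<in>{C \<in> components p red_edges. bound (min_of L C) = Suc c}. card C)"
  unfolding red_def red_chains_def red_edges_def[symmetric]
  by (simp add: nth_default_chains_to_comp finite_components chain_pos_def bound_def)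

text \<open>
  The surviving edges of \<open>des\<close> preserve \<open>bound\<close>. So a whole chain sits at its own position, and
  the chains at position \<open>Suc c\<close> together make up the level set.
\<close>

lemma nth_default_des:
  "nth_default 0 (des p L \<rho>) c = card {i \<in> {1..p}. bound i = Suc c}"
proof -
  let ?A = "{C \<in> components p des_edges. bound (min_of L C) = Suc c}"
  have pos: "bound (min_of L C) = bound i" if "C \<in> components p des_edges" "i \<in> C" for C i
  proof (rule constant_on_component[OF bound_des_edge that(1)])
    show "min_of L C \<in> C"
      using min_of_spec[OF component_subset[OF des_edges_carrier that(1)]
          component_nonempty[OF that(1)]] by blast
  qed (use that in auto)
  have sub: "C \<subseteq> {1..p}" if "C \<in> components p des_edges" for C
    by (rule component_subset[OF des_edges_carrier that])
  have "nth_default 0 (des p L \<rho>) c = (\<Sum>C\<in>?A. card C)"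
    unfolding des_def des_chains_def des_edges_def[symmetric]
    by (simp add: nth_default_chains_to_comp finite_components chain_pos_def bound_def)
  also have "\<dots> = card (\<Union>?A)"
  proof (rule card_Union_disjoint[symmetric])
    show "pairwise disjnt ?A"
      by (rule pairwise_subset[OF components_disjoint]) blast
    show "finite C" if "C \<in> ?A" for C
      using that sub finite_subset[OF _ finite_atLeastAtMost] by blast
  qed
  also have "\<Union>?A = {i \<in> {1..p}. bound i = Suc c}"
  proof (intro equalityI subsetI)
    fix i assume "i \<in> \<Union>?A"
    then obtain C where C: "C \<in> components p des_edges" "bound (min_of L C) = Suc c" "i \<in> C"
      by blast
    then show "i \<in> {i \<in> {1..p}. bound i = Suc c}"
      using sub[OF C(1)] pos[OF C(1,3)] by auto
  next
    fix i assume i: "i \<in> {i \<in> {1..p}. bound i = Suc c}"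
    then have "i \<in> {1..p}"
      by blast
    then obtain C where C: "C \<in> components p des_edges" "i \<in> C"
      by (rule in_some_component)
    then show "i \<in> \<Union>?A"
      using pos[OF C] i by auto
  qed
  finally show ?thesis .
qed

lemma bound_range: "bound \<in> {1..p} \<rightarrow> {1..length (des p L \<rho>)}"
proof (rule funcsetI)
  fix i assume i: "i \<in> {1..p}"
  then have pos: "1 \<le> bound i"
    using rho_bar_pos[OF i] int_bound[OF i] by simp
  with i have "i \<in> {j \<in> {1..p}. bound j = Suc (bound i - 1)}"
    by simp
  then have "card {j \<in> {1..p}. bound j = Suc (bound i - 1)} \<noteq> 0"
    by (subst card_0_eq) auto
  then have "nth_default 0 (des p L \<rho>) (bound i - 1) \<noteq> 0"
    unfolding nth_default_des .
  then have "bound i - 1 < length (des p L \<rho>)"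
    by (simp add: nth_default_def split: if_splits)
  with pos show "bound i \<in> {1..length (des p L \<rho>)}"
    by simp
qed

lemma des_eq_level_counts: "des p L \<rho> = level_counts p (length (des p L \<rho>)) bound"
proof (rule nth_equalityI)
  fix c assume "c < length (des p L \<rho>)"
  with nth_default_des[of c] show "des p L \<rho> ! c = level_counts p (length (des p L \<rho>)) bound ! c"
    by (simp add: nth_default_nth nth_level_counts)
qed simp

lemma red_eq_des:
  assumes ascent: "\<And>i j. covered_by L i j \<Longrightarrow> i < j \<Longrightarrow> rho_bar L \<rho> i = rho_bar L \<rho> j"
  shows "red p L \<rho> = des p L \<rho>"
proof -
  have "i > j \<longleftrightarrow> rho_bar L \<rho> i < rho_bar L \<rho> j" if "covered_by L i j" for i j
  proof
    note ij = covered_byD[OF that]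
    assume "i > j"
    with bound_descent[OF ij(5)] show "rho_bar L \<rho> i < rho_bar L \<rho> j"
      using int_bound ij(3,4) by (metis of_nat_less_iff)
  next
    assume "rho_bar L \<rho> i < rho_bar L \<rho> j"
    with ascent[OF that] covered_byD(2)[OF that] show "i > j"
      by (cases "i < j") auto
  qed
  then have "red_edges = des_edges"
    unfolding red_edges_def des_edges_def by blast
  then show ?thesis
    unfolding red_def des_def red_chains_def des_chains_def red_edges_def des_edges_def by simp
qed

text \<open>
  It suffices to compare supports. An ascending cover with \<open>bound i < bound j\<close> makes part \<open>bound j\<close>
  of \<open>des\<close> positive; no chain of \<open>red\<close> can start at that value, since its least element would
  have to be found below \<open>j\<close>, at \<open>j\<close> or above \<open>j\<close>, and each place is impossible.
\<close>

lemma ascent_of_same_weak_comp: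
  assumes same: "same_weak_comp (red p L \<rho>) (des p L \<rho>)"
    and cover: "covered_by L i j" and "i < j"
  shows "bound i = bound j"
proof (rule ccontr)
  assume "bound i \<noteq> bound j"
  note ij = covered_byD[OF cover]
  with \<open>bound i \<noteq> bound j\<close> bound_mono have less: "bound i < bound j"
    by (meson le_neq_implies_less)
  (* List entries count from 0, so the part at position bound j has index bound j - 1. *)
  have "j \<in> {k \<in> {1..p}. bound k = Suc (bound j - 1)}"
    using ij(4) less by simp
  then have "nth_default 0 (des p L \<rho>) (bound j - 1) \<noteq> 0"
    unfolding nth_default_des by (subst card_0_eq) auto
  then have "nth_default 0 (red p L \<rho>) (bound j - 1) \<noteq> 0"
    using same_weak_comp_nth_default[OF same, of "bound j - 1"] by simp
  then have "{C \<in> components p red_edges. bound (min_of L C) = Suc (bound j - 1)} \<noteq> {}"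
    unfolding nth_default_red using sum.empty by metis
  then obtain C where C: "C \<in> components p red_edges" "bound (min_of L C) = bound j"
    using less by auto
  define m where "m = min_of L C"
  have sub: "C \<subseteq> {1..p}"
    by (rule component_subset[OF red_edges_carrier C(1)])
  have m: "m \<in> C" "\<And>x. x \<in> C \<Longrightarrow> (m, x) \<in> L"
    using min_of_spec[OF sub component_nonempty[OF C(1)]] by (auto simp: m_def)
  have "m \<noteq> j"
  proof
    assume "m = j"
    have "(i, j) \<in> red_edges"
      using cover \<open>i < j\<close> by (simp add: red_edges_def)
    with component_closed[OF C(1) m(1)] \<open>m = j\<close> have "i \<in> C"
      by blast
    with m(2) \<open>m = j\<close> ij(1,2) antisym show False
      by blast
  qed
  have "(m, j) \<notin> L"
  proof
    assume "(m, j) \<in> L"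
    with \<open>m \<noteq> j\<close> have "(m, i) \<in> L"
      by (intro below_cover[OF cover]) (simp add: strictly_below_def)
    with bound_mono[of m i] C(2) less show False
      by (simp add: m_def)
  qed
  with \<open>m \<noteq> j\<close> total[OF ij(4), of m] m(1) sub have "strictly_below L j m"
    by (auto simp: strictly_below_def)
  then obtain k where k: "(j, k) \<in> L" "covered_by L k m"
    by (rule obtain_predecessor)
  show False
  proof (cases "k > m")
    case True
    with bound_descent[OF covered_byD(5)[OF k(2)]] bound_mono[OF k(1)] C(2) show False
      by (simp add: m_def)
  next
    case False
    with k(2) have "(k, m) \<in> red_edges"
      by (simp add: red_edges_def)
    with component_closed[OF C(1) m(1)] have "k \<in> C"
      by blast
    with m(2) covered_byD(1,2)[OF k(2)] antisym show False
      by blast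
  qed
qed

lemma same_weak_comp_iff:
  "same_weak_comp (red p L \<rho>) (des p L \<rho>) \<longleftrightarrow>
    (\<forall>i j. covered_by L i j \<and> i < j \<longrightarrow> rho_bar L \<rho> i = rho_bar L \<rho> j)"
proof
  assume same: "same_weak_comp (red p L \<rho>) (des p L \<rho>)"
  show "\<forall>i j. covered_by L i j \<and> i < j \<longrightarrow> rho_bar L \<rho> i = rho_bar L \<rho> j"
  proof (intro allI impI)
    fix i j assume ij: "covered_by L i j \<and> i < j"
    then have "bound i = bound j"
      using ascent_of_same_weak_comp[OF same] by blast
    moreover have "i \<in> {1..p}" "j \<in> {1..p}"
      using covered_byD ij by blast+
    ultimately show "rho_bar L \<rho> i = rho_bar L \<rho> j"
      by (simp flip: int_bound)
  qed
next
  assume "\<forall>i j. covered_by L i j \<and> i < j \<longrightarrow> rho_bar L \<rho> i = rho_bar L \<rho> j"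
  then show "same_weak_comp (red p L \<rho>) (des p L \<rho>)"
    using red_eq_des by (simp add: same_weak_comp_def)
qed

lemma partition_poly_eq_slide_poly_red:
  assumes "same_weak_comp (red p L \<rho>) (des p L \<rho>)"
  shows "partition_poly p L \<rho> = slide_poly (red p L \<rho>)"
proof -
  have "bounded_partitions p L \<rho> = bounded_partitions p L (rho_bar L \<rho>)"
    by (rule bounded_partitions_rho_bar[symmetric])
  also have "\<dots> = bounded_partitions p L (\<lambda>i. int (bound i))"
    unfolding bounded_partitions_def using int_bound by auto
  also have "\<dots> = staircase_maps bound"
    using bound_mono bound_descent ascent_of_same_weak_comp[OF assms]
    by (rule bounded_partitions_eq_staircase_maps)
  finally have "partition_poly p L \<rho> = slide_poly (level_counts p (length (des p L \<rho>)) bound)"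
    using slide_poly_level_counts[OF bound_range bound_mono] by (simp add: partition_poly_def)
  moreover have "red p L \<rho> = des p L \<rho>"
    using red_eq_des assms same_weak_comp_iff by blast
  ultimately show ?thesis
    by (simp flip: des_eq_level_counts)
qed

end

section \<open>Every slide polynomial arises\<close>

text \<open>
  The bound \<open>r\<close> has level sizes \<open>a\<close> and weakly decreases with the label, while the order runs by increasing
  \<open>r\<close>. So labels descend exactly where \<open>r\<close> increases, and the bounded partitions for \<open>r\<close> itself are
  the staircase maps of \<open>r\<close>.
\<close>

lemma slide_poly_is_partition_poly:
  fixes a :: "nat list"
  obtains p L and \<rho> :: "nat \<Rightarrow> int"
  where "linear_order_on {1..p} L" "\<forall>i\<in>{1..p}. \<rho> i \<ge> 1" "partition_poly p L \<rho> = slide_poly a"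
proof -
  define p where "p = sum_list a"
  define r where "r i = quantile a (Suc p - i)" for i
  define L where "L = {(i, j). i \<in> {1..p} \<and> j \<in> {1..p} \<and> (r i < r j \<or> r i = r j \<and> i \<le> j)}"
  have r: "r \<in> {1..p} \<rightarrow> {1..length a}"
  proof (rule funcsetI)
    fix i assume "i \<in> {1..p}"
    then have "Suc p - i \<in> {1..sum_list a}"
      by (auto simp: p_def)
    then show "r i \<in> {1..length a}"
      unfolding r_def by (rule quantile_in_range)
  qed
  have antimono: "r j \<le> r i" if "i < j" "i \<in> {1..p}" for i j
    unfolding r_def by (rule quantile_mono) (use that in \<open>auto simp: p_def\<close>)
  have linear: "linear_order_on {1..p} L"
    unfolding linear_order_on_def partial_order_on_def preorder_on_def
  proof (intro conjI)
    show "trans L" "antisym L" "total_on {1..p} L" "refl_on {1..p} L"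
      by (auto simp: L_def trans_def antisym_def total_on_def refl_on_def)
  qed (auto simp: L_def)
  then interpret labeled_chain p L
    by unfold_locales (simp_all add: linear_order_on_def)
  have counts: "level_counts p (length a) r = a"
    unfolding r_def
  proof (rule level_counts_quantile)
    show "bij_betw (\<lambda>i. Suc p - i) {1..p} {1..p}"
      by (rule bij_betw_byWitness[where f' = "\<lambda>i. Suc p - i"]) auto
  qed (rule p_def)
  have r_mono: "r i \<le> r j" if "(i, j) \<in> L" for i j
    using that by (auto simp: L_def)
  have "bounded_partitions p L (\<lambda>i. int (r i)) = staircase_maps r"
  proof (rule bounded_partitions_eq_staircase_maps[OF r_mono])
    show "r i < r j" if "strictly_below L i j" "i > j" for i j
      using that by (auto simp: strictly_below_def L_def)
    show "r i = r j" if "covered_by L i j" "i < j" for i j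
      using antimono[OF that(2)] r_mono[of i j] covered_byD[OF that(1)] by simp
  qed
  then have "partition_poly p L (\<lambda>i. int (r i)) = slide_poly a"
    using slide_poly_level_counts[OF r r_mono] by (simp add: partition_poly_def counts)
  moreover have "\<forall>i\<in>{1..p}. int (r i) \<ge> 1"
    using funcset_interval_bounds(1)[OF r] by fastforce
  ultimately show ?thesis
    by (rule that[OF linear, rotated])
qed

section \<open>The characterization\<close>

theorem proposition3p10:
  shows
    "(\<forall>(p :: nat) (L :: nat rel) (\<rho> :: nat \<Rightarrow> int).
        linear_order_on {1..p} L \<and>
        (\<forall>i\<in>{1..p}. \<rho> i \<ge> 1) \<and>
        (\<forall>i\<in>{1..p}. rho_bar L \<rho> i \<ge> 1) \<longrightarrow>
          (same_weak_comp (red p L \<rho>) (des p L \<rho>) \<longleftrightarrow>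
             (\<forall>i j. covered_by L i j \<and> i < j \<longrightarrow> rho_bar L \<rho> i = rho_bar L \<rho> j)) \<and>
          (same_weak_comp (red p L \<rho>) (des p L \<rho>) \<longrightarrow>
             partition_poly p L \<rho> = slide_poly (red p L \<rho>)))
     \<and> (\<forall>a :: nat list. \<exists>(p :: nat) (L :: nat rel) (\<rho> :: nat \<Rightarrow> int).
          linear_order_on {1..p} L \<and>
          (\<forall>i\<in>{1..p}. \<rho> i \<ge> 1) \<and>
          partition_poly p L \<rho> = slide_poly a)"
proof (intro conjI allI impI; (elim conjE)?)
  fix p L and \<rho> :: "nat \<Rightarrow> int"
  assume linear: "linear_order_on {1..p} L" and pos: "\<forall>i\<in>{1..p}. rho_bar L \<rho> i \<ge> 1"
  interpret bounded_chain p L \<rho>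
    by unfold_locales (use linear pos in \<open>simp_all add: linear_order_on_def\<close>)
  show "same_weak_comp (red p L \<rho>) (des p L \<rho>) \<longleftrightarrow>
      (\<forall>i j. covered_by L i j \<and> i < j \<longrightarrow> rho_bar L \<rho> i = rho_bar L \<rho> j)"
    by (rule same_weak_comp_iff)
  show "partition_poly p L \<rho> = slide_poly (red p L \<rho>)"
    if "same_weak_comp (red p L \<rho>) (des p L \<rho>)"
    by (rule partition_poly_eq_slide_poly_red[OF that])
next
  fix a :: "nat list"
  show "\<exists>p L (\<rho> :: nat \<Rightarrow> int). linear_order_on {1..p} L \<and> (\<forall>i\<in>{1..p}. \<rho> i \<ge> 1) \<and>
      partition_poly p L \<rho> = slide_poly a"
    using slide_poly_is_partition_poly by metis
qed

end
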